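(* Let $a\in\mathbb{R}^N$, and define $M=\max(a_1,\dots,a_N)$ and $m=\min(a_1,\dots,a_N)$. The sectional curvature $\kappa$ of $(\mathbb{R}^{N+1},g_a)$ satisfies the following bounds. (1) If all the coordinates $a_i$ are of the same sign, then $$-M^2\le\kappa\le-m^2.$$ (2) Otherwise, $$-\max(M^2,m^2)\le\kappa\le-Mm.$$
   Context: For $a=(a_1,\dots,a_N)\in\mathbb{R}^N$, $g_a$ is the Riemannian metric on $\mathbb{R}^{N+1}$ given by $g_a=\sum_{i=1}^{N}e^{-2a_ix_{N+1}}\,dx_i^2+dx_{N+1}^2$.
   Formalization: In (1), the printed bounds are proved when all a_i ≥ 0; when all a_i ≤ 0 they are false as printed (e.g. a=(-1,-2)) and are replaced by -m² ≤ κ ≤ -M². "Same sign" is read weakly, zeros allowed. *)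

theory Defs
  imports "HOL-Analysis.Analysis"
begin

text \<open>
  A Riemannian metric on $R^k$ is given by its bilinear forms: \<open>g x u v\<close> is the inner product of
  the tangent vectors \<open>u\<close> and \<open>v\<close> at the point \<open>x\<close>.
\<close>

type_synonym 'k metric_tensor = "real^'k \<Rightarrow> real^'k \<Rightarrow> real^'k \<Rightarrow> real"

definition partial_deriv :: "'k::finite \<Rightarrow> (real^'k \<Rightarrow> real) \<Rightarrow> real^'k \<Rightarrow> real" where
  "partial_deriv i f x = deriv (\<lambda>t. f (x + t *\<^sub>R axis i 1)) 0"

definition metric_coeff :: "'k::finite metric_tensor \<Rightarrow> 'k \<Rightarrow> 'k \<Rightarrow> real^'k \<Rightarrow> real" where
  "metric_coeff g i j x = g x (axis i 1) (axis j 1)"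

definition metric_coeff_inv :: "'k::finite metric_tensor \<Rightarrow> 'k \<Rightarrow> 'k \<Rightarrow> real^'k \<Rightarrow> real" where
  "metric_coeff_inv g i j x = matrix_inv (\<chi> p q. metric_coeff g p q x) $ i $ j"

text \<open>
  \<open>christoffel g l i j\<close> is the coefficient $\Gamma^l_{ij}$ of the Levi-Civita connection.
\<close>

definition christoffel :: "'k::finite metric_tensor \<Rightarrow> 'k \<Rightarrow> 'k \<Rightarrow> 'k \<Rightarrow> real^'k \<Rightarrow> real" where
  "christoffel g l i j x =
     (\<Sum>p\<in>UNIV. metric_coeff_inv g l p x *
        (partial_deriv i (metric_coeff g j p) x + partial_deriv j (metric_coeff g i p) x
          - partial_deriv p (metric_coeff g i j) x)) / 2"

text \<open>
  \<open>riemann_coeff g l i j k\<close> is the \<open>l\<close>-th coordinate of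
  $R(\partial_i,\partial_j)\partial_k =
    \nabla_i\nabla_j\partial_k - \nabla_j\nabla_i\partial_k$.
\<close>

definition riemann_coeff ::
    "'k::finite metric_tensor \<Rightarrow> 'k \<Rightarrow> 'k \<Rightarrow> 'k \<Rightarrow> 'k \<Rightarrow> real^'k \<Rightarrow> real" where
  "riemann_coeff g l i j k x =
     partial_deriv i (christoffel g l j k) x - partial_deriv j (christoffel g l i k) x
     + (\<Sum>p\<in>UNIV. christoffel g l i p x * christoffel g p j k x
                  - christoffel g l j p x * christoffel g p i k x)"

definition riemann_curvature ::
    "'k::finite metric_tensor \<Rightarrow> real^'k \<Rightarrow> real^'k \<Rightarrow> real^'k \<Rightarrow> real^'k \<Rightarrow> real^'k" where
  "riemann_curvature g x u v w =
     (\<chi> l. \<Sum>i\<in>UNIV. \<Sum>j\<in>UNIV. \<Sum>k\<in>UNIV. riemann_coeff g l i j k x * u $ i * v $ j * w $ k)"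

text \<open>
  The sectional curvature at \<open>x\<close> of the plane spanned by the linearly independent vectors
  \<open>u\<close> and \<open>v\<close> (positive on round spheres).
\<close>

definition sectional_curvature ::
    "'k::finite metric_tensor \<Rightarrow> real^'k \<Rightarrow> real^'k \<Rightarrow> real^'k \<Rightarrow> real" where
  "sectional_curvature g x u v =
     g x (riemann_curvature g x u v v) u / (g x u u * g x v v - (g x u v)\<^sup>2)"

text \<open>
  With $N$ the cardinality of \<open>'n\<close>, $R^{N+1}$ is \<open>real^'n option\<close>: the index \<open>Some i\<close> stands for
  the coordinate $x_i$ with $i \le N$, and \<open>None\<close> for the last coordinate $x_{N+1}$.
\<close>

definition g_metric :: "real^'n::finite \<Rightarrow> ('n option) metric_tensor" where
  "g_metric a x u v =
     (\<Sum>i\<in>UNIV. exp (- 2 * a $ i * x $ None) * u $ Some i * v $ Some i) + u $ None * v $ None"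

end

theory Submission
  imports Defs
begin

text \<open>
  Write $t = x_{N+1}$ and $E_i = e^{-2 a_i t}$. The only non-zero Christoffel symbols are
  $\Gamma^t_{ii} = a_i E_i$ and $\Gamma^i_{it} = \Gamma^i_{ti} = -a_i$. Hence the numerator of the
  sectional curvature is
  $-\sum_i a_i^2 E_i (u_t v_i - v_t u_i)^2
   - \frac12 \sum_{i,j} a_i a_j E_i E_j (u_i v_j - u_j v_i)^2$,
  while by Lagrange's identity its denominator is the same expression with all the factors
  $-a_i^2$ and $-a_i a_j$ removed. The sectional curvature is thus a weighted mean of the numbers
  $-a_i a_j$, and it remains to bound the products $a_i a_j$.
\<close>

section \<open>Summation identities\<close>

text \<open>Expanding the square gives products of single sums; the half appears because every
  unordered pair of indices is counted twice. The weights may be negative: the identity serves for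
  the metric coefficients and for their multiples by \<open>a $ i\<close>.\<close>

lemma lagrange_identity_weighted:
  fixes c u v :: "'i \<Rightarrow> real"
  shows "(\<Sum>i\<in>I. c i * u i * u i) * (\<Sum>i\<in>I. c i * v i * v i) - (\<Sum>i\<in>I. c i * u i * v i)\<^sup>2
    = (\<Sum>i\<in>I. \<Sum>j\<in>I. c i * c j * (u i * v j - u j * v i)\<^sup>2) / 2"
proof -
  let ?S = "\<lambda>f g. \<Sum>i\<in>I. \<Sum>j\<in>I. (c i * f i) * (c j * g j)"
  have "(\<Sum>i\<in>I. \<Sum>j\<in>I. c i * c j * (u i * v j - u j * v i)\<^sup>2)
      = ?S (\<lambda>i. u i * u i) (\<lambda>i. v i * v i) + ?S (\<lambda>i. v i * v i) (\<lambda>i. u i * u i)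
        - 2 * ?S (\<lambda>i. u i * v i) (\<lambda>i. u i * v i)"
    unfolding sum_distrib_left sum.distrib[symmetric] sum_subtractf[symmetric]
    by (intro sum.cong refl) (simp add: power2_eq_square algebra_simps)
  then show ?thesis
    unfolding sum_product[symmetric] by (simp add: power2_eq_square mult.assoc)
qed

text \<open>Pulls the contraction over \<open>p\<close> outwards, which turns the quadratic
  Christoffel terms of the curvature into an iterated bilinear map.\<close>

lemma sum_bilinear_comp:
  fixes C D :: "'k \<Rightarrow> 'k \<Rightarrow> 'k \<Rightarrow> real"
  shows "(\<Sum>i\<in>I. \<Sum>j\<in>I. \<Sum>k\<in>I. (\<Sum>p\<in>I. C l i p * D p j k) * u i * v j * w k)
    = (\<Sum>i\<in>I. \<Sum>p\<in>I. C l i p * u i * (\<Sum>j\<in>I. \<Sum>k\<in>I. D p j k * v j * w k))"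
proof (rule sum.cong[OF refl])
  fix i
  have "(\<Sum>j\<in>I. \<Sum>k\<in>I. (\<Sum>p\<in>I. C l i p * D p j k) * u i * v j * w k)
    = (\<Sum>j\<in>I. \<Sum>k\<in>I. \<Sum>p\<in>I. C l i p * u i * (D p j k * v j * w k))"
    unfolding sum_distrib_right by (simp add: mult_ac)
  also have "\<dots> = (\<Sum>j\<in>I. \<Sum>p\<in>I. \<Sum>k\<in>I. C l i p * u i * (D p j k * v j * w k))"
    by (intro sum.cong refl sum.swap)
  also have "\<dots> = (\<Sum>p\<in>I. \<Sum>j\<in>I. \<Sum>k\<in>I. C l i p * u i * (D p j k * v j * w k))"
    by (rule sum.swap)
  finally show "(\<Sum>j\<in>I. \<Sum>k\<in>I. (\<Sum>p\<in>I. C l i p * D p j k) * u i * v j * w k)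
      = (\<Sum>p\<in>I. C l i p * u i * (\<Sum>j\<in>I. \<Sum>k\<in>I. D p j k * v j * w k))"
    by (simp add: sum_distrib_left)
qed

section \<open>Index-free form of the curvature tensor\<close>

text \<open>The covariant derivative in direction \<open>u\<close> of the vector field with constant
  coordinates \<open>v\<close>.\<close>

definition connection_form ::
    "'k::finite metric_tensor \<Rightarrow> real^'k \<Rightarrow> real^'k \<Rightarrow> real^'k \<Rightarrow> real^'k" where
  "connection_form g x u v =
     (\<chi> l. \<Sum>i\<in>UNIV. \<Sum>j\<in>UNIV. christoffel g l i j x * u $ i * v $ j)"

definition connection_form_deriv ::
    "'k::finite metric_tensor \<Rightarrow> real^'k \<Rightarrow> real^'k \<Rightarrow> real^'k \<Rightarrow> real^'k \<Rightarrow> real^'k" where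
  "connection_form_deriv g x u v w =
     (\<chi> l. \<Sum>i\<in>UNIV. \<Sum>j\<in>UNIV. \<Sum>k\<in>UNIV.
        partial_deriv i (christoffel g l j k) x * u $ i * v $ j * w $ k)"

text \<open>For constant, hence commuting, vector fields the curvature is the commutator of
  covariant derivatives; each iterated one splits into a derivative of the symbols and a nested
  connection form.\<close>

lemma riemann_curvature_connection_form:
  "riemann_curvature g x u v w =
     connection_form_deriv g x u v w - connection_form_deriv g x v u w
     + connection_form g x u (connection_form g x v w)
     - connection_form g x v (connection_form g x u w)"
proof -
  have "riemann_curvature g x u v w $ l =
     connection_form_deriv g x u v w $ l - connection_form_deriv g x v u w $ l
     + connection_form g x u (connection_form g x v w) $ l
     - connection_form g x v (connection_form g x u w) $ l" for l
  proof -
    let ?G = "\<lambda>l i j. christoffel g l i j x"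
    let ?D = "\<lambda>i j k. partial_deriv i (christoffel g l j k) x"
    \<comment> \<open>Exchanging the first two summation indices pairs \<open>u\<close> with
      \<open>i\<close> and \<open>v\<close> with \<open>j\<close>, as in
      \<open>riemann_curvature\<close>.\<close>
    have swapD: "connection_form_deriv g x v u w $ l
        = (\<Sum>i\<in>UNIV. \<Sum>j\<in>UNIV. \<Sum>k\<in>UNIV. ?D j i k * u $ i * v $ j * w $ k)"
      unfolding connection_form_deriv_def vec_lambda_beta
      by (rule trans[OF sum.swap]) (intro sum.cong refl, simp)
    have comp: "connection_form g x u (connection_form g x v w) $ l
        = (\<Sum>i\<in>UNIV. \<Sum>j\<in>UNIV. \<Sum>k\<in>UNIV. (\<Sum>p\<in>UNIV. ?G l i p * ?G p j k) * u $ i * v $ j * w $ k)"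
      for u v
      unfolding connection_form_def vec_lambda_beta
      by (rule sum_bilinear_comp[symmetric])
    have swapG: "connection_form g x v (connection_form g x u w) $ l
        = (\<Sum>i\<in>UNIV. \<Sum>j\<in>UNIV. \<Sum>k\<in>UNIV. (\<Sum>p\<in>UNIV. ?G l j p * ?G p i k) * u $ i * v $ j * w $ k)"
      unfolding comp by (rule trans[OF sum.swap]) (intro sum.cong refl, simp)
    show ?thesis
      unfolding swapD swapG
      unfolding comp
      unfolding riemann_curvature_def riemann_coeff_def connection_form_deriv_def vec_lambda_beta
      by (simp add: sum.distrib sum_subtractf distrib_right left_diff_distrib)
  qed
  then show ?thesis
    by (simp add: vec_eq_iff)
qed

section \<open>The metric in coordinates and its inverse\<close>

text \<open>
  The exponents are extended by the value $0$ at the index of $x_{N+1}$, so that all the diagonal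
  entries of $g_a$, including the last one, have the form $e^{-2 a_p x_{N+1}}$.
\<close>

definition exponent :: "real^'n::finite \<Rightarrow> 'n option \<Rightarrow> real" where
  "exponent a p = (case p of None \<Rightarrow> 0 | Some i \<Rightarrow> a $ i)"

definition diag_coeff :: "real^'n::finite \<Rightarrow> real^'n option \<Rightarrow> 'n option \<Rightarrow> real" where
  "diag_coeff a x p = exp (- 2 * exponent a p * x $ None)"

lemma exponent_simps [simp]: "exponent a None = 0" "exponent a (Some i) = a $ i"
  by (simp_all add: exponent_def)

lemma diag_coeff_None [simp]: "diag_coeff a x None = 1"
  by (simp add: diag_coeff_def)

lemma diag_coeff_pos: "0 < diag_coeff a x p"
  by (simp add: diag_coeff_def)

lemma sum_UNIV_option:
  "(\<Sum>p\<in>(UNIV :: 'n::finite option set). f p) = f None + (\<Sum>i\<in>UNIV. f (Some i))"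
  by (simp add: UNIV_option_conv sum.reindex)

lemma g_metric_diag:
  "g_metric a x u v = (\<Sum>p\<in>UNIV. diag_coeff a x p * u $ p * v $ p)"
  by (simp add: g_metric_def sum_UNIV_option diag_coeff_def)

lemma metric_coeff_g_metric:
  "metric_coeff (g_metric a) p q x = (if p = q then diag_coeff a x p else 0)"
proof -
  \<comment> \<open>The test on the summation index is made outermost, so that the sum collapses by
    simplification; later sums are prepared in the same way.\<close>
  have "metric_coeff (g_metric a) p q x
      = (\<Sum>r\<in>UNIV. if r = p then (if p = q then diag_coeff a x p else 0) else 0)"
    unfolding metric_coeff_def g_metric_diag
    by (intro sum.cong refl) (auto simp: axis_def)
  then show ?thesis by simp
qed

text \<open>\<open>matrix_inv\<close> chooses some two-sided inverse, so uniqueness of inverses must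
  identify it with \<open>B\<close>.\<close>

lemma matrix_inv_eqI:
  fixes A B :: "'a::semiring_1^'n^'n"
  assumes "A ** B = mat 1" "B ** A = mat 1"
  shows "matrix_inv A = B"
proof -
  have inv: "A ** matrix_inv A = mat 1 \<and> matrix_inv A ** A = mat 1"
    unfolding matrix_inv_def using assms
    by (rule someI[where P = "\<lambda>C. A ** C = mat 1 \<and> C ** A = mat 1", OF conjI])
  have "matrix_inv A ** (A ** B) = (matrix_inv A ** A) ** B"
    by (rule matrix_mul_assoc)
  with inv show ?thesis
    by (simp add: assms)
qed

lemma matrix_mult_diagonal:
  fixes c d :: "'k::finite \<Rightarrow> real"
  shows "(\<chi> p q. if p = q then c p else 0) ** (\<chi> p q. if p = q then d p else 0)
    = (\<chi> p q. if p = q then c p * d p else 0)"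
proof -
  have "(\<Sum>k\<in>UNIV. (if p = k then c p else 0) * (if k = q then d k else 0))
      = (\<Sum>k\<in>UNIV. if k = p then (if p = q then c p * d p else 0) else 0)" for p q
    by (intro sum.cong refl) auto
  then show ?thesis
    by (simp add: matrix_matrix_mult_def)
qed

lemma matrix_inv_diagonal:
  fixes d :: "'k::finite \<Rightarrow> real"
  assumes "\<And>p. d p \<noteq> 0"
  shows "matrix_inv (\<chi> p q. if p = q then d p else 0) = (\<chi> p q. if p = q then inverse (d p) else 0)"
  using assms by (intro matrix_inv_eqI) (simp_all add: matrix_mult_diagonal mat_def vec_eq_iff)

lemma metric_coeff_inv_g_metric:
  "metric_coeff_inv (g_metric a) p q x = (if p = q then inverse (diag_coeff a x p) else 0)"
  unfolding metric_coeff_inv_def metric_coeff_g_metric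
  using diag_coeff_pos[of a x] by (subst matrix_inv_diagonal) (auto simp: less_le)

section \<open>Christoffel symbols and their derivatives\<close>

text \<open>The free factor \<open>c\<close> is 1 for the metric coefficients and
  \<open>exponent a i\<close> for the Christoffel symbols.\<close>

lemma partial_deriv_diag_coeff:
  "partial_deriv r (\<lambda>x. c * diag_coeff a x p) x
     = (if r = None then - 2 * exponent a p * c * diag_coeff a x p else 0)"
proof (cases "r = None")
  case True
  have "((\<lambda>t. c * diag_coeff a (x + t *\<^sub>R axis r 1) p) has_real_derivative
      - 2 * exponent a p * c * diag_coeff a x p) (at 0)"
    unfolding diag_coeff_def using True
    by (auto intro!: derivative_eq_intros simp: axis_def)
  then show ?thesis
    using True by (simp add: partial_deriv_def DERIV_imp_deriv)
next
  case False
  then show ?thesis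
    by (auto simp: partial_deriv_def diag_coeff_def axis_def)
qed

lemma partial_deriv_const [simp]: "partial_deriv r (\<lambda>x. c) x = 0"
  by (simp add: partial_deriv_def)

lemma partial_deriv_metric_coeff_g_metric:
  "partial_deriv r (metric_coeff (g_metric a) p q) x
     = (if p = q \<and> r = None then - 2 * exponent a p * diag_coeff a x p else 0)"
  using partial_deriv_diag_coeff[of r 1 a p x]
  by (cases "p = q") (simp_all add: metric_coeff_g_metric[abs_def])

text \<open>Only the term \<open>p = l\<close> survives the diagonal inverse, which cancels the
  exponential in the mixed symbols and leaves constants. The three cases overlap only when all
  indices are \<open>None\<close>, where \<open>exponent\<close> vanishes.\<close>

lemma christoffel_g_metric:
  "christoffel (g_metric a) l i j x =
     (if l = None \<and> i = j then exponent a i * diag_coeff a x i else 0)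
     - (if i = None \<and> j = l then exponent a l else 0)
     - (if j = None \<and> i = l then exponent a l else 0)"
proof -
  have "christoffel (g_metric a) l i j x = inverse (diag_coeff a x l) *
      (partial_deriv i (metric_coeff (g_metric a) j l) x
       + partial_deriv j (metric_coeff (g_metric a) i l) x
       - partial_deriv l (metric_coeff (g_metric a) i j) x) / 2"
    by (simp add: christoffel_def metric_coeff_inv_g_metric if_distrib if_distribR cong: if_cong)
  also have "\<dots> =
     (if l = None \<and> i = j then exponent a i * diag_coeff a x i else 0)
     - (if i = None \<and> j = l then exponent a l else 0)
     - (if j = None \<and> i = l then exponent a l else 0)"
    using diag_coeff_pos[of a x l]
    by (auto simp: partial_deriv_metric_coeff_g_metric field_simps)
  finally show ?thesis .
qed

lemma partial_deriv_christoffel_g_metric: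
  "partial_deriv r (christoffel (g_metric a) l i j) x =
     (if r = None \<and> l = None \<and> i = j then - 2 * (exponent a i)\<^sup>2 * diag_coeff a x i else 0)"
proof (cases "l = None \<and> i = j")
  case True
  then have "christoffel (g_metric a) l i j = (\<lambda>x. exponent a i * diag_coeff a x i)"
    by (auto simp: christoffel_g_metric fun_eq_iff)
  then show ?thesis
    using True by (simp add: partial_deriv_diag_coeff power2_eq_square)
next
  case False
  then have "christoffel (g_metric a) l i j = (\<lambda>x.
     - (if i = None \<and> j = l then exponent a l else 0)
     - (if j = None \<and> i = l then exponent a l else 0))"
    by (auto simp: christoffel_g_metric fun_eq_iff)
  then show ?thesis
    using False by auto
qed

section \<open>The connection in terms of fundamental forms\<close>

text \<open>This is the metric paired with the \<open>n\<close>-th power of the shape operator of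
  the slices of constant last coordinate, extended by 0 to the normal direction. For
  \<open>n = 0\<close> it is the metric, for \<open>n = 1\<close> the second fundamental
  form.\<close>

definition weighted_form :: "nat \<Rightarrow> real^'n::finite \<Rightarrow> ('n option) metric_tensor" where
  "weighted_form n a x u v = (\<Sum>p\<in>UNIV. exponent a p ^ n * diag_coeff a x p * u $ p * v $ p)"

lemma weighted_form_commute: "weighted_form n a x u v = weighted_form n a x v u"
  by (simp add: weighted_form_def mult_ac)

lemma connection_form_g_metric:
  "connection_form (g_metric a) x u v $ l =
     (if l = None then weighted_form 1 a x u v else 0)
     - exponent a l * (u $ None * v $ l + u $ l * v $ None)"
proof -
  have "connection_form (g_metric a) x u v $ l =
      (\<Sum>i\<in>UNIV. \<Sum>j\<in>UNIV.
         (if j = i then (if l = None then exponent a i * diag_coeff a x i * u $ i * v $ i else 0) else 0)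
       - (if j = l then (if i = None then exponent a l * u $ None * v $ l else 0) else 0)
       - (if j = None then (if i = l then exponent a l * u $ l * v $ None else 0) else 0))"
    unfolding connection_form_def vec_lambda_beta
    by (intro sum.cong refl) (auto simp: christoffel_g_metric algebra_simps)
  also have "\<dots> = (if l = None then weighted_form 1 a x u v else 0)
     - exponent a l * (u $ None * v $ l + u $ l * v $ None)"
    unfolding sum_subtractf by (auto simp: weighted_form_def distrib_left mult.assoc)
  finally show ?thesis .
qed

lemma connection_form_deriv_g_metric:
  fixes a :: "real^'n::finite"
  shows "connection_form_deriv (g_metric a) x u v w $ l =
     (if l = None then - 2 * u $ None * weighted_form 2 a x v w else 0)"
proof -
  have "connection_form_deriv (g_metric a) x u v w $ l =
      (\<Sum>i\<in>(UNIV :: 'n option set). \<Sum>j\<in>UNIV. \<Sum>k\<in>UNIV. if k = j then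
         (if i = None then (if l = None then
            - 2 * u $ None * ((exponent a j)\<^sup>2 * diag_coeff a x j * v $ j * w $ j) else 0) else 0) else 0)"
    unfolding connection_form_deriv_def vec_lambda_beta
    by (intro sum.cong refl) (auto simp: partial_deriv_christoffel_g_metric)
  also have "\<dots> = (\<Sum>i\<in>(UNIV :: 'n option set). if i = None then (\<Sum>j\<in>UNIV. if l = None then
            - 2 * u $ None * ((exponent a j)\<^sup>2 * diag_coeff a x j * v $ j * w $ j) else 0) else 0)"
    by (intro sum.cong refl) auto
  also have "\<dots> = (if l = None then - 2 * u $ None * weighted_form 2 a x v w else 0)"
    by (auto simp: weighted_form_def sum_distrib_left)
  finally show ?thesis .
qed

text \<open>Each factor \<open>exponent a l\<close> in the connection raises the power by one. The
  normal component has exponent 0 and so contributes only for \<open>n = 0\<close>, which the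
  convention \<open>0 ^ 0 = 1\<close> expresses.\<close>

lemma weighted_form_connection_form:
  "weighted_form n a x (connection_form (g_metric a) x u v) z =
     0 ^ n * weighted_form 1 a x u v * z $ None
     - (u $ None * weighted_form (Suc n) a x v z + v $ None * weighted_form (Suc n) a x u z)"
proof -
  have "weighted_form n a x (connection_form (g_metric a) x u v) z =
    (\<Sum>p\<in>UNIV. (if p = None then 0 ^ n * weighted_form 1 a x u v * z $ None else 0)
      - (u $ None * (exponent a p ^ Suc n * diag_coeff a x p * v $ p * z $ p)
       + v $ None * (exponent a p ^ Suc n * diag_coeff a x p * u $ p * z $ p)))"
    unfolding weighted_form_def[of n] connection_form_g_metric
    by (intro sum.cong refl) (auto simp: algebra_simps)
  then show ?thesis
    by (simp add: sum_subtractf sum.distrib weighted_form_def sum_distrib_left)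
qed

lemma g_metric_weighted_form: "g_metric a x u v = weighted_form 0 a x u v"
  by (simp add: g_metric_diag weighted_form_def)

lemma weighted_form_add_left:
  "weighted_form n a x (u + u') v = weighted_form n a x u v + weighted_form n a x u' v"
  by (simp add: weighted_form_def sum.distrib algebra_simps)

lemma weighted_form_diff_left:
  "weighted_form n a x (u - u') v = weighted_form n a x u v - weighted_form n a x u' v"
  by (simp add: weighted_form_def sum_subtractf algebra_simps)

lemma weighted_form_scaleR_left:
  "weighted_form n a x (c *\<^sub>R u) v = c * weighted_form n a x u v"
  by (simp add: weighted_form_def sum_distrib_left mult_ac)

lemma weighted_form_connection_form_deriv:
  fixes a :: "real^'n::finite"
  shows "weighted_form 0 a x (connection_form_deriv (g_metric a) x u v w) z
     = - 2 * u $ None * z $ None * weighted_form 2 a x v w"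
proof -
  have "weighted_form 0 a x (connection_form_deriv (g_metric a) x u v w) z
      = (\<Sum>p\<in>(UNIV :: 'n option set). if p = None then - 2 * u $ None * z $ None * weighted_form 2 a x v w else 0)"
    unfolding weighted_form_def[of 0] connection_form_deriv_g_metric
    by (intro sum.cong refl) auto
  then show ?thesis by simp
qed

section \<open>Numerator and denominator of the sectional curvature\<close>

text \<open>The last difference is the Gauss equation term of the slices; the other terms are minus
  the form with \<open>n = 2\<close> at the vector
  \<open>u $ None *\<^sub>R v - v $ None *\<^sub>R u\<close>, paired with itself.\<close>

lemma g_metric_riemann_curvature:
  "g_metric a x (riemann_curvature (g_metric a) x u v v) u =
     2 * u $ None * v $ None * weighted_form 2 a x u v
     - (u $ None)\<^sup>2 * weighted_form 2 a x v v - (v $ None)\<^sup>2 * weighted_form 2 a x u u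
     - (weighted_form 1 a x u u * weighted_form 1 a x v v - (weighted_form 1 a x u v)\<^sup>2)"
proof -
  have None: "connection_form (g_metric a) x u v $ None = weighted_form 1 a x u v" for u v
    by (simp add: connection_form_g_metric)
  \<comment> \<open>An inner connection form may land in the second argument; commuting brings it to
    the first, where \<open>weighted_form_connection_form\<close> applies again.\<close>
  have comm: "weighted_form n a x u (connection_form (g_metric a) x v w)
      = weighted_form n a x (connection_form (g_metric a) x v w) u" for n u v w
    by (rule weighted_form_commute)
  show ?thesis
    unfolding g_metric_weighted_form[of a x _ u]
      riemann_curvature_connection_form weighted_form_add_left weighted_form_diff_left
      weighted_form_connection_form_deriv
    by (simp add: weighted_form_connection_form None comm weighted_form_commute[of _ a x v u]
        power2_eq_square algebra_simps numeral_2_eq_2)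
qed

text \<open>The terms of power 2 complete a square in each coordinate; the terms of power 1 fall
  under the Lagrange identity.\<close>

lemma g_metric_riemann_curvature_eq_sum:
  "g_metric a x (riemann_curvature (g_metric a) x u v v) u =
     - (\<Sum>i\<in>UNIV. a $ i * a $ i * (diag_coeff a x (Some i)
          * (u $ None * v $ Some i - v $ None * u $ Some i)\<^sup>2))
     - (\<Sum>i\<in>UNIV. \<Sum>j\<in>UNIV. a $ i * a $ j * (diag_coeff a x (Some i) * diag_coeff a x (Some j)
          * (u $ Some i * v $ Some j - u $ Some j * v $ Some i)\<^sup>2)) / 2"
proof -
  have 1: "weighted_form 1 a x u v = (\<Sum>i\<in>UNIV. a $ i * diag_coeff a x (Some i) * u $ Some i * v $ Some i)"
    for u v by (simp add: weighted_form_def sum_UNIV_option)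
  have 2: "weighted_form 2 a x u v = (\<Sum>i\<in>UNIV. (a $ i)\<^sup>2 * diag_coeff a x (Some i) * u $ Some i * v $ Some i)"
    for u v by (simp add: weighted_form_def sum_UNIV_option)
  have sq: "2 * u $ None * v $ None * weighted_form 2 a x u v
     - (u $ None)\<^sup>2 * weighted_form 2 a x v v - (v $ None)\<^sup>2 * weighted_form 2 a x u u
    = - (\<Sum>i\<in>UNIV. a $ i * a $ i * (diag_coeff a x (Some i)
          * (u $ None * v $ Some i - v $ None * u $ Some i)\<^sup>2))"
    unfolding 2 sum_distrib_left sum_subtractf[symmetric] sum_negf[symmetric]
    by (intro sum.cong refl) (simp add: power2_eq_square algebra_simps)
  show ?thesis
    unfolding g_metric_riemann_curvature sq 1 lagrange_identity_weighted
    by (simp add: mult_ac)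
qed

lemma g_metric_gram_eq_sum:
  "g_metric a x u u * g_metric a x v v - (g_metric a x u v)\<^sup>2 =
     (\<Sum>i\<in>UNIV. diag_coeff a x (Some i) * (u $ None * v $ Some i - v $ None * u $ Some i)\<^sup>2)
     + (\<Sum>i\<in>UNIV. \<Sum>j\<in>UNIV. diag_coeff a x (Some i) * diag_coeff a x (Some j)
          * (u $ Some i * v $ Some j - u $ Some j * v $ Some i)\<^sup>2) / 2"
proof -
  \<comment> \<open>The pairs (\<open>None\<close>, \<open>Some i\<close>) and
    (\<open>Some i\<close>, \<open>None\<close>) give the same square, which absorbs the factor
    1/2.\<close>
  have "(u $ None * v $ Some i - u $ Some i * v $ None)\<^sup>2
      = (u $ None * v $ Some i - v $ None * u $ Some i)\<^sup>2"
    "(u $ Some i * v $ None - u $ None * v $ Some i)\<^sup>2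
      = (u $ None * v $ Some i - v $ None * u $ Some i)\<^sup>2" for i
    by (simp_all add: power2_eq_square algebra_simps)
  then show ?thesis
    unfolding g_metric_diag lagrange_identity_weighted
    unfolding sum_UNIV_option
    by (simp add: sum.distrib)
qed

section \<open>Positivity of the denominator\<close>

lemma g_metric_pos:
  assumes "u \<noteq> 0"
  shows "0 < g_metric a x u u"
proof -
  obtain p where p: "u $ p \<noteq> 0"
    using assms by (auto simp: vec_eq_iff)
  show ?thesis
    unfolding g_metric_diag mult.assoc
    using p diag_coeff_pos[of a x]
    by (intro sum_pos2[of _ p]) (auto simp: less_imp_le zero_less_mult_iff linorder_neq_iff)
qed

text \<open>Strict Cauchy-Schwarz inequality. Distinctness is a separate hypothesis because for
  \<open>u = v\<close> the set \<open>{u, v}\<close> is a singleton, which may be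
  independent.\<close>

lemma g_metric_gram_pos:
  assumes "u \<noteq> v" "independent {u, v}"
  shows "0 < g_metric a x u u * g_metric a x v v - (g_metric a x u v)\<^sup>2"
proof -
  have v: "v \<noteq> 0"
    using assms dependent_zero by blast
  \<comment> \<open>The component of \<open>u\<close> orthogonal to \<open>v\<close>, scaled to
    avoid division; its squared length is \<open>g_metric a x v v\<close> times the Gram
    determinant.\<close>
  define w where "w = g_metric a x v v *\<^sub>R u - g_metric a x u v *\<^sub>R v"
  have gv: "0 < g_metric a x v v"
    using v by (rule g_metric_pos)
  have "w \<noteq> 0"
  proof
    assume "w = 0"
    then have "u = (g_metric a x u v / g_metric a x v v) *\<^sub>R v"
      using gv by (simp add: w_def vec_eq_iff field_simps)
    then have "u \<in> span {v}"
      by (metis insertI1 span_base span_scale)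
    moreover have "{u, v} - {u} = {v}"
      using assms by auto
    ultimately show False
      using assms by (auto simp: dependent_def)
  qed
  then have "0 < g_metric a x w w"
    by (rule g_metric_pos)
  also have "g_metric a x w w
      = g_metric a x v v * (g_metric a x u u * g_metric a x v v - (g_metric a x u v)\<^sup>2)"
  proof -
    have right: "weighted_form 0 a x y w
        = g_metric a x v v * weighted_form 0 a x u y - g_metric a x u v * weighted_form 0 a x v y" for y
      by (subst weighted_form_commute)
        (simp add: w_def weighted_form_diff_left weighted_form_scaleR_left)
    show ?thesis
      by (simp add: g_metric_weighted_form[of a x w w] right)
        (simp add: w_def weighted_form_diff_left weighted_form_scaleR_left g_metric_weighted_form
          weighted_form_commute[of 0 a x v u] power2_eq_square algebra_simps)
  qed
  finally show ?thesis
    using gv by (simp add: zero_less_mult_iff)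
qed

section \<open>Curvature bounds from bounds on products\<close>

text \<open>Numerator and denominator share the nonnegative weights \<open>P i\<close> and
  \<open>Q i j\<close>. The squares multiplying \<open>P i\<close> are covered by the bounds with
  \<open>i = j\<close>.\<close>

lemma sectional_curvature_g_metric_bounds:
  fixes a :: "real^'n::finite"
  assumes uv: "u \<noteq> v" "independent {u, v}"
    and lower: "\<And>i j. L \<le> a $ i * a $ j" and upper: "\<And>i j. a $ i * a $ j \<le> U"
  shows "- U \<le> sectional_curvature (g_metric a) x u v
    \<and> sectional_curvature (g_metric a) x u v \<le> - L"
proof -
  define P where "P i = diag_coeff a x (Some i) * (u $ None * v $ Some i - v $ None * u $ Some i)\<^sup>2" for i
  define Q where "Q i j = diag_coeff a x (Some i) * diag_coeff a x (Some j)
    * (u $ Some i * v $ Some j - u $ Some j * v $ Some i)\<^sup>2" for i j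
  have nonneg: "0 \<le> P i" "0 \<le> Q i j" for i j
    by (simp_all add: P_def Q_def diag_coeff_pos less_imp_le)
  define num where "num = g_metric a x (riemann_curvature (g_metric a) x u v v) u"
  define den where "den = g_metric a x u u * g_metric a x v v - (g_metric a x u v)\<^sup>2"
  have num: "num = - (\<Sum>i\<in>UNIV. a $ i * a $ i * P i) - (\<Sum>i\<in>UNIV. \<Sum>j\<in>UNIV. a $ i * a $ j * Q i j) / 2"
    unfolding num_def P_def Q_def by (rule g_metric_riemann_curvature_eq_sum)
  have den: "den = (\<Sum>i\<in>UNIV. P i) + (\<Sum>i\<in>UNIV. \<Sum>j\<in>UNIV. Q i j) / 2"
    unfolding den_def P_def Q_def by (rule g_metric_gram_eq_sum)
  have "L * (\<Sum>i\<in>UNIV. P i) \<le> (\<Sum>i\<in>UNIV. a $ i * a $ i * P i)"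
    "(\<Sum>i\<in>UNIV. a $ i * a $ i * P i) \<le> U * (\<Sum>i\<in>UNIV. P i)"
    "L * (\<Sum>i\<in>UNIV. \<Sum>j\<in>UNIV. Q i j) \<le> (\<Sum>i\<in>UNIV. \<Sum>j\<in>UNIV. a $ i * a $ j * Q i j)"
    "(\<Sum>i\<in>UNIV. \<Sum>j\<in>UNIV. a $ i * a $ j * Q i j) \<le> U * (\<Sum>i\<in>UNIV. \<Sum>j\<in>UNIV. Q i j)"
    unfolding sum_distrib_left
    by (intro sum_mono mult_right_mono lower upper nonneg)+
  then have "- U * den \<le> num" "num \<le> - L * den"
    by (simp_all add: num den algebra_simps)
  moreover have "0 < den"
    unfolding den_def using uv by (rule g_metric_gram_pos)
  ultimately show ?thesis
    by (simp add: sectional_curvature_def num_def[symmetric] den_def[symmetric] field_simps)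
qed

text \<open>The product is affine in each factor, so each can be moved to an endpoint in turn; the
  sign of \<open>b\<close> decides which endpoint \<open>c\<close> goes to.\<close>

lemma mult_ge_mult_endpoints:
  fixes m M b c :: real
  assumes "m \<le> 0" "0 \<le> M" "m \<le> b" "b \<le> M" "m \<le> c" "c \<le> M"
  shows "M * m \<le> b * c"
proof (cases "0 \<le> b")
  case True
  have "M * m \<le> b * m"
    using assms by (simp add: mult_right_mono_neg)
  also have "\<dots> \<le> b * c"
    using assms True by (simp add: mult_left_mono)
  finally show ?thesis .
next
  case False
  have "M * m \<le> M * b"
    using assms by (simp add: mult_left_mono)
  also have "\<dots> \<le> c * b"
    using assms False by (simp add: mult_right_mono_neg)
  finally show ?thesis by (simp add: mult.commute)
qed

text \<open>The product is at most the mean of the two squares, and a square on an interval is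
  largest at an endpoint.\<close>

lemma mult_le_max_square_endpoints:
  fixes m M b c :: real
  assumes "m \<le> b" "b \<le> M" "m \<le> c" "c \<le> M"
  shows "b * c \<le> max (M\<^sup>2) (m\<^sup>2)"
proof -
  have sq: "d\<^sup>2 \<le> max (M\<^sup>2) (m\<^sup>2)" if "m \<le> d" "d \<le> M" for d
  proof (cases "0 \<le> d")
    case True
    with that have "d\<^sup>2 \<le> M\<^sup>2" by (intro power_mono) auto
    then show ?thesis by simp
  next
    case False
    with that have "(- d)\<^sup>2 \<le> (- m)\<^sup>2" by (intro power_mono) auto
    then show ?thesis by simp
  qed
  have "0 \<le> (b - c)\<^sup>2" by simp
  then have "2 * (b * c) \<le> b\<^sup>2 + c\<^sup>2" by (simp add: power2_diff)
  with sq[of b] sq[of c] assms show ?thesis by linarith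
qed

text \<open>Same sign is taken in the weak sense. Squaring reverses the order of nonpositive
  numbers, so \<open>M\<close> and \<open>m\<close> exchange roles in that case.\<close>

theorem proposition6:
  fixes a :: "real^'n::finite" and M m :: real
  assumes M: "M = Max (range (\<lambda>i. a $ i))"
    and m: "m = Min (range (\<lambda>i. a $ i))"
  shows "\<forall>(x :: real^'n option) u v. u \<noteq> v \<and> independent {u, v} \<longrightarrow>
      ((\<forall>i. 0 \<le> a $ i) \<longrightarrow>
         - M\<^sup>2 \<le> sectional_curvature (g_metric a) x u v \<and>
         sectional_curvature (g_metric a) x u v \<le> - m\<^sup>2) \<and>
      ((\<forall>i. a $ i \<le> 0) \<longrightarrow>
         - m\<^sup>2 \<le> sectional_curvature (g_metric a) x u v \<and>
         sectional_curvature (g_metric a) x u v \<le> - M\<^sup>2) \<and>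
      (\<not> ((\<forall>i. 0 \<le> a $ i) \<or> (\<forall>i. a $ i \<le> 0)) \<longrightarrow>
         - max (M\<^sup>2) (m\<^sup>2) \<le> sectional_curvature (g_metric a) x u v \<and>
         sectional_curvature (g_metric a) x u v \<le> - (M * m))"
proof (intro allI impI)
  fix x u v :: "real^'n option"
  assume uv: "u \<noteq> v \<and> independent {u, v}"
  note bounds = sectional_curvature_g_metric_bounds[OF conjunct1[OF uv] conjunct2[OF uv]]
  have le: "m \<le> a $ i" "a $ i \<le> M" for i
    by (auto simp: M m)
  \<comment> \<open>Both extrema are attained, so sign conditions on the coordinates pass to
    \<open>M\<close> and \<open>m\<close>.\<close>
  have "M \<in> range (\<lambda>i. a $ i)" "m \<in> range (\<lambda>i. a $ i)"
    unfolding M m by (intro Max_in Min_in; simp)+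
  then obtain k l where kl: "M = a $ k" "m = a $ l"
    by auto
  show "((\<forall>i. 0 \<le> a $ i) \<longrightarrow>
         - M\<^sup>2 \<le> sectional_curvature (g_metric a) x u v \<and>
         sectional_curvature (g_metric a) x u v \<le> - m\<^sup>2) \<and>
      ((\<forall>i. a $ i \<le> 0) \<longrightarrow>
         - m\<^sup>2 \<le> sectional_curvature (g_metric a) x u v \<and>
         sectional_curvature (g_metric a) x u v \<le> - M\<^sup>2) \<and>
      (\<not> ((\<forall>i. 0 \<le> a $ i) \<or> (\<forall>i. a $ i \<le> 0)) \<longrightarrow>
         - max (M\<^sup>2) (m\<^sup>2) \<le> sectional_curvature (g_metric a) x u v \<and>
         sectional_curvature (g_metric a) x u v \<le> - (M * m))"
  proof (intro conjI[OF impI conjI[OF impI impI]])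
    assume nonneg: "\<forall>i. 0 \<le> a $ i"
    show "- M\<^sup>2 \<le> sectional_curvature (g_metric a) x u v \<and>
         sectional_curvature (g_metric a) x u v \<le> - m\<^sup>2"
    proof (rule bounds)
      fix i j
      have "0 \<le> m" "0 \<le> M" using nonneg kl by auto
      then show "m\<^sup>2 \<le> a $ i * a $ j" "a $ i * a $ j \<le> M\<^sup>2"
        using nonneg le by (simp_all add: power2_eq_square mult_mono)
    qed
  next
    assume nonpos: "\<forall>i. a $ i \<le> 0"
    show "- m\<^sup>2 \<le> sectional_curvature (g_metric a) x u v \<and>
         sectional_curvature (g_metric a) x u v \<le> - M\<^sup>2"
    proof (rule bounds)
      fix i j
      have "m \<le> 0" "M \<le> 0" using nonpos kl by auto
      \<comment> \<open>Negating all factors makes them nonnegative, as monotonicity of the product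
        requires.\<close>
      then have "(- M) * (- M) \<le> (- a $ i) * (- a $ j)" "(- a $ i) * (- a $ j) \<le> (- m) * (- m)"
        using nonpos le by (intro mult_mono; simp)+
      then show "M\<^sup>2 \<le> a $ i * a $ j" "a $ i * a $ j \<le> m\<^sup>2"
        by (simp_all add: power2_eq_square)
    qed
  next
    assume "\<not> ((\<forall>i. 0 \<le> a $ i) \<or> (\<forall>i. a $ i \<le> 0))"
    then obtain i j where "a $ i < 0" "0 < a $ j"
      by (auto simp: not_le)
    then have "m \<le> 0" "0 \<le> M"
      using le(1)[of i] le(2)[of j] by linarith+
    then show "- max (M\<^sup>2) (m\<^sup>2) \<le> sectional_curvature (g_metric a) x u v \<and>
         sectional_curvature (g_metric a) x u v \<le> - (M * m)"
      using le by (intro bounds mult_ge_mult_endpoints mult_le_max_square_endpoints)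
  qed
qed

end
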